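(* Let $n\ge2$ and let $\mathcal{A}^B_n$ be the set of $B$-arc permutations in $B_n$. Then $$\sum_{\pi\in\mathcal{A}^B_n}t^{\mathrm{fdes}(\pi)}q^{\mathrm{fmaj}(\pi)}=\frac{(1+tq)(1+tq^n)}{1-q}\left((1-tq^n)\prod_{i=1}^{n-2}(1+t^2q^{2i+1})-(1-t)q\prod_{i=1}^{n-2}(1+t^2q^{2i+2})\right),$$ and $$\sum_{\pi\in\mathcal{A}^B_n}t^{\mathrm{fdes}(\pi)}=(1+t)^3 (1+t^2)^{n-3} (1+(n-2)t+t^2).$$
   Context: $B_n$ is the group of bijections $\pi$ of $\{\pm1,\dots,\pm n\}$ with $\pi(-a)=-\pi(a)$, written $\pi=[\pi(1),\dots,\pi(n)]$. Let $\mathcal{O}_n$ be a circle with $2n$ points labeled $-1,\dots,-n,1,\dots,n$ in clockwise order; an interval in $\mathcal{O}_n$ is a set of cyclically consecutive points. $\pi\in B_n$ is a $B$-arc permutation if for every $1\le j\le n$ the set $\{\pi(j),\dots,\pi(n)\}$ is an interval in $\mathcal{O}_n$. Descents are with respect to the order $-1<-2<\cdots<-n<1<\cdots<n$: $\mathrm{Des}(\pi)=\{1\le i\le n-1:\pi(i)>\pi(i+1)\}$, $\mathrm{des}=|\mathrm{Des}|$, $\mathrm{maj}(\pi)=\sum_{i\in\mathrm{Des}(\pi)}i$, $\mathrm{neg}(\pi)=\#\{i:\pi(i)<0\}$, $\mathrm{fmaj}(\pi)=2\,\mathrm{maj}(\pi)+\mathrm{neg}(\pi)$, $\mathrm{fdes}(\pi)=2\,\mathrm{des}(\pi)+\delta(\pi(1)<0)$,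 where $\delta(\pi(1)<0)$ is $1$ if $\pi(1)<0$ and $0$ otherwise. *)

theory Defs
  imports Complex_Main "HOL-Combinatorics.Permutations"
begin

definition signed_points :: "nat \<Rightarrow> int set" where
  "signed_points n = {- int n..int n} - {0}"

text \<open>Being a function on all integers, an element of \<open>B_group n\<close> is extended by the identity
  outside the set of signed points, so distinct elements are distinct bijections of that set.\<close>
definition B_group :: "nat \<Rightarrow> (int \<Rightarrow> int) set" where
  "B_group n = {\<pi>. \<pi> permutes signed_points n \<and> (\<forall>a\<in>signed_points n. \<pi> (- a) = - \<pi> a)}"

text \<open>Label of the point reached from \<open>-1\<close> after \<open>k\<close> clockwise steps on the circle whose points are
  \<open>-1, \<dots>, -n, 1, \<dots>, n\<close> in clockwise order.\<close>
definition circle_point :: "nat \<Rightarrow> nat \<Rightarrow> int" where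
  "circle_point n k =
     (let r = k mod (2 * n) in if r < n then - (int r + 1) else int r - int n + 1)"

definition circle_interval :: "nat \<Rightarrow> int set \<Rightarrow> bool" where
  "circle_interval n S \<longleftrightarrow> (\<exists>s m. S = circle_point n ` {s..<s + m})"

definition B_arc_permutations :: "nat \<Rightarrow> (int \<Rightarrow> int) set" where
  "B_arc_permutations n =
     {\<pi> \<in> B_group n. \<forall>j\<in>{1..n}. circle_interval n (\<pi> ` {int j..int n})}"

text \<open>The order \<open>-1 < -2 < \<dots> < -n < 1 < \<dots> < n\<close>.\<close>
definition B_less :: "int \<Rightarrow> int \<Rightarrow> bool" where
  "B_less a b \<longleftrightarrow>
     (a < 0 \<and> b < 0 \<and> b < a) \<or> (a < 0 \<and> 0 < b) \<or> (0 < a \<and> 0 < b \<and> a < b)"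

definition Des :: "nat \<Rightarrow> (int \<Rightarrow> int) \<Rightarrow> nat set" where
  "Des n \<pi> = {i. 1 \<le> i \<and> i \<le> n - 1 \<and> B_less (\<pi> (int (i + 1))) (\<pi> (int i))}"

definition des :: "nat \<Rightarrow> (int \<Rightarrow> int) \<Rightarrow> nat" where
  "des n \<pi> = card (Des n \<pi>)"

definition maj :: "nat \<Rightarrow> (int \<Rightarrow> int) \<Rightarrow> nat" where
  "maj n \<pi> = (\<Sum>i\<in>Des n \<pi>. i)"

definition neg :: "nat \<Rightarrow> (int \<Rightarrow> int) \<Rightarrow> nat" where
  "neg n \<pi> = card {i \<in> {1..n}. \<pi> (int i) < 0}"

definition fmaj :: "nat \<Rightarrow> (int \<Rightarrow> int) \<Rightarrow> nat" where
  "fmaj n \<pi> = 2 * maj n \<pi> + neg n \<pi>"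

definition fdes :: "nat \<Rightarrow> (int \<Rightarrow> int) \<Rightarrow> nat" where
  "fdes n \<pi> = 2 * des n \<pi> + (if \<pi> 1 < 0 then 1 else 0)"

end

theory Submission
  imports Defs
begin

text \<open>Reading a \<open>B\<close>-arc permutation from left to right empties an arc of \<open>n\<close> points of the circle by
  repeatedly deleting one of its two end points. Number the points \<open>0, \<dots>, 2n - 1\<close> in the given
  order and put \<open>y\<^sub>0 = t\<close>, \<open>y\<^sub>i = t\<^sup>2 q\<^sup>2\<^sup>i\<close>. If the arc does not contain the step from \<open>2n - 1\<close> to \<open>0\<close>,
  then \<open>i\<close> is a descent exactly if the right end is deleted at time \<open>i\<close>, and the weights factor.
  If it does, it consists of \<open>h\<close> large positive and \<open>k\<close> small negative points, and as long as both
  blocks are nonempty a descent at \<open>i\<close> means that the entry \<open>i + 1\<close> is negative; hence the total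
  weight satisfies \<open>U\<^sub>i(h, k) = U\<^sub>i\<^sub>+\<^sub>1(h - 1, k) + y\<^sub>i U\<^sub>i\<^sub>+\<^sub>1(h, k - 1)\<close>, where \<open>i\<close> counts the deletions
  already made. Summing \<open>q\<^sup>k U\<^sub>i(h, k)\<close> over \<open>h + k = m\<close> gives a first-order recursion in \<open>m\<close>, which
  is solved in closed form.\<close>

section \<open>Coordinates and arcs on the circle\<close>

lemma circle_point_eq_iff:
  assumes "0 < n"
  shows "circle_point n a = circle_point n b \<longleftrightarrow> a mod (2 * n) = b mod (2 * n)"
  using assms by (auto simp: circle_point_def Let_def)

lemma circle_point_neg_iff: "circle_point n k < 0 \<longleftrightarrow> k mod (2 * n) < n"
  by (auto simp: circle_point_def Let_def)

text \<open>Antipodal points carry opposite labels, so \<open>n\<close> consecutive points never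
  contain a point together with its negative.\<close>

lemma circle_point_add_half:
  assumes "0 < n"
  shows "circle_point n (k + n) = - circle_point n k"
proof -
  define r where "r = k mod (2 * n)"
  have r: "r < 2 * n" using assms by (simp add: r_def)
  have "(k + n) mod (2 * n) = (r + n) mod (2 * n)" by (simp add: r_def mod_add_left_eq)
  also have "\<dots> = (if r < n then r + n else r - n)"
    using r by (auto simp: mod_if le_mod_geq)
  finally show ?thesis
    using r by (auto simp: circle_point_def Let_def simp flip: r_def)
qed

text \<open>The clockwise reading from \<open>-1\<close> lists the points in increasing order, which
  turns every descent condition into a comparison of residues.\<close>

lemma B_less_circle_point:
  assumes "0 < n"
  shows "B_less (circle_point n a) (circle_point n b) \<longleftrightarrow> a mod (2 * n) < b mod (2 * n)"
  using assms mod_less_divisor[of "2 * n" a] mod_less_divisor[of "2 * n" b]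
  by (auto simp: B_less_def circle_point_def Let_def)

lemma circle_point_in_signed_points:
  assumes "0 < n"
  shows "circle_point n k \<in> signed_points n"
proof -
  have "k mod (2 * n) < 2 * n" using assms by simp
  then show ?thesis
    unfolding signed_points_def circle_point_def Let_def by (auto simp del: mod_less_divisor)
qed

lemma circle_point_add_modulus [simp]: "circle_point n (k + 2 * n) = circle_point n k"
  by (simp add: circle_point_def)

text \<open>The residue is the clockwise distance from \<open>a\<close> to \<open>b\<close>. It is
  taken over the integers because natural subtraction would truncate.\<close>

lemma circle_point_in_arc_iff:
  assumes "0 < n" "m \<le> 2 * n"
  shows "circle_point n b \<in> circle_point n ` {a..<a + m} \<longleftrightarrow>
    (int b - int a) mod int (2 * n) < int m"
proof
  assume "circle_point n b \<in> circle_point n ` {a..<a + m}"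
  then obtain k where k: "a \<le> k" "k < a + m" "b mod (2 * n) = k mod (2 * n)"
    using assms by (auto simp: circle_point_eq_iff)
  then have "int b mod int (2 * n) = int k mod int (2 * n)"
    by (metis of_nat_mod)
  then have "(int b - int a) mod int (2 * n) = (int k - int a) mod int (2 * n)"
    by (rule mod_diff_cong) simp
  also have "\<dots> = int k - int a" using k assms by (intro mod_pos_pos_trivial) auto
  finally show "(int b - int a) mod int (2 * n) < int m" using k by simp
next
  define d where "d = nat ((int b - int a) mod int (2 * n))"
  assume *: "(int b - int a) mod int (2 * n) < int m"
  have d: "int d = (int b - int a) mod int (2 * n)" using assms by (simp add: d_def)
  have "int (a + d) mod int (2 * n) = int b mod int (2 * n)"
    by (simp add: d mod_add_right_eq)
  then have "(a + d) mod (2 * n) = b mod (2 * n)"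
    by (metis of_nat_mod of_nat_eq_iff)
  then have "circle_point n b = circle_point n (a + d)"
    using assms by (simp add: circle_point_eq_iff)
  moreover have "d < m" using * d by simp
  ultimately show "circle_point n b \<in> circle_point n ` {a..<a + m}" by auto
qed

text \<open>The start of a proper arc is its only point whose predecessor lies outside the arc.\<close>
lemma arc_start_unique:
  assumes "0 < n" "m < 2 * n" "0 < b"
    and "circle_point n b \<in> circle_point n ` {a..<a + m}"
    and "circle_point n (b - 1) \<notin> circle_point n ` {a..<a + m}"
  shows "b mod (2 * n) = a mod (2 * n)"
proof -
  define d where "d = (int b - int a) mod int (2 * n)"
  have d: "0 \<le> d" "d < int m" "d < int (2 * n)"
    using assms by (auto simp: d_def circle_point_in_arc_iff)
  have pred: "int (b - 1) - int a = int b - int a - 1" using assms by simp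
  have "\<not> (int (b - 1) - int a) mod int (2 * n) < int m"
    using assms(5) circle_point_in_arc_iff[OF assms(1), of m "b - 1" a] assms(2) by simp
  then have "\<not> (d - 1) mod int (2 * n) < int m"
    by (simp only: pred d_def mod_diff_left_eq not_False_eq_True)
  then have "d = 0"
    using d by (smt (verit) mod_pos_pos_trivial)
  then have "int b mod int (2 * n) = int a mod int (2 * n)"
    by (simp add: d_def mod_eq_dvd_iff dvd_eq_mod_eq_0)
  then show ?thesis by (metis of_nat_mod of_nat_eq_iff)
qed

lemma inj_on_circle_point:
  assumes "0 < n" "m \<le> 2 * n"
  shows "inj_on (circle_point n) {a..<a + m}"
proof (rule inj_onI)
  fix x y assume "x \<in> {a..<a + m}" "y \<in> {a..<a + m}" "circle_point n x = circle_point n y"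
  then show "x = y"
  proof (induction x y rule: linorder_wlog)
    case (le x y)
    then have "2 * n dvd y - x" using assms by (metis circle_point_eq_iff mod_eq_dvd_iff_nat)
    moreover have "y - x < 2 * n" using le assms by auto
    ultimately show ?case using le(1) by (auto dest: nat_dvd_not_less)
  qed auto
qed

section \<open>Lists that empty an arc from its ends\<close>

text \<open>The start \<open>a\<close> is not reduced, so an arc may run past the point
  \<open>2n - 1\<close>. For \<open>m = 0\<close> the two branches are the same set, and a single
  point is counted once.\<close>

primrec arc_lists :: "nat \<Rightarrow> nat \<Rightarrow> nat \<Rightarrow> int list set" where
  "arc_lists n a 0 = {[]}"
| "arc_lists n a (Suc m) =
     (#) (circle_point n a) ` arc_lists n (a + 1) m \<union>
     (#) (circle_point n (a + m)) ` arc_lists n a m"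

lemma finite_arc_lists [simp]: "finite (arc_lists n a m)"
  by (induction m arbitrary: a) auto

lemma arc_lists_cong:
  assumes "0 < n" "a mod (2 * n) = b mod (2 * n)"
  shows "arc_lists n a m = arc_lists n b m"
  using assms(2)
proof (induction m arbitrary: a b)
  case (Suc m)
  have shift: "(a + k) mod (2 * n) = (b + k) mod (2 * n)" for k
    using Suc.prems by (rule mod_add_cong) simp
  have point: "circle_point n (a + k) = circle_point n (b + k)" for k
    using assms(1) shift by (simp only: circle_point_eq_iff)
  show ?case
    unfolding arc_lists.simps Suc.IH[OF Suc.prems] Suc.IH[OF shift[of 1]] point[of m] point[of 0, simplified] ..
qed simp

text \<open>All lists of an arc rearrange the same points; their set, length and number of negative
  entries are read off from this.\<close>

lemma arc_lists_mset:
  "xs \<in> arc_lists n a m \<Longrightarrow> mset xs = image_mset (circle_point n) (mset [a..<a + m])"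
proof (induction m arbitrary: a xs)
  case (Suc m)
  have unfold_left: "[a..<a + Suc m] = a # [Suc a..<Suc a + m]" by (simp add: upt_conv_Cons)
  from Suc.prems consider ys where "xs = circle_point n a # ys" "ys \<in> arc_lists n (a + 1) m"
    | ys where "xs = circle_point n (a + m) # ys" "ys \<in> arc_lists n a m" by auto
  then show ?case
  proof cases
    case 1 then show ?thesis using Suc.IH[OF 1(2)] unfolding unfold_left
      by (simp del: mset_upt add: flip: mset_map)
  next
    case 2 then show ?thesis using Suc.IH[OF 2(2)] by (simp)
  qed
qed simp

lemma arc_lists_set: "xs \<in> arc_lists n a m \<Longrightarrow> set xs = circle_point n ` {a..<a + m}"
  by (drule arc_lists_mset, drule arg_cong[where f = set_mset]) simp

lemma arc_lists_length: "xs \<in> arc_lists n a m \<Longrightarrow> length xs = m"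
  by (drule arc_lists_mset, drule arg_cong[where f = size]) simp

lemma arc_lists_distinct:
  assumes "xs \<in> arc_lists n a m" "0 < n" "m \<le> 2 * n"
  shows "distinct xs"
proof -
  have "card (set xs) = m"
    unfolding arc_lists_set[OF assms(1)] by (simp add: card_image inj_on_circle_point assms)
  then show ?thesis using arc_lists_length[OF assms(1)] by (simp add: card_distinct)
qed

lemma arc_lists_suffix_interval:
  assumes "xs \<in> arc_lists n a m"
  shows "circle_interval n (set (drop j xs))"
  using assms
proof (induction m arbitrary: a xs j)
  case 0
  then show ?case by (auto simp: circle_interval_def intro!: exI[of _ 0])
next
  case (Suc m)
  show ?case
  proof (cases j)
    case 0
    then show ?thesis
      unfolding circle_interval_def using arc_lists_set[OF Suc.prems] by (metis drop0)
  next
    case (Suc i)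
    then show ?thesis using Suc.prems Suc.IH by auto
  qed
qed

text \<open>More than \<open>2 * n\<close> consecutive steps cover the whole circle, so a proper
  interval has as many steps as points. Shifting the start by a full turn makes it positive, so that
  \<open>s - 1\<close> is a genuine predecessor.\<close>

lemma interval_card_bounded:
  assumes "0 < n" "circle_interval n S" "card S = m" "m < 2 * n"
  obtains s where "S = circle_point n ` {s..<s + m}" "0 < s"
proof -
  from assms obtain s k where S: "S = circle_point n ` {s..<s + k}"
    by (auto simp: circle_interval_def)
  have "k = m"
  proof (cases "k \<le> 2 * n")
    case True
    then show ?thesis using assms S by (simp add: card_image inj_on_circle_point)
  next
    case False
    then have "card (circle_point n ` {s..<s + 2 * n}) \<le> card S"
      unfolding S by (intro card_mono) auto
    then show ?thesis using assms by (simp add: card_image inj_on_circle_point)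
  qed
  have "circle_point n ` {s + 2 * n..<s + 2 * n + m} = S"
    unfolding S \<open>k = m\<close>
  proof -
    have "{s + 2 * n..<s + 2 * n + m} = (\<lambda>k. k + 2 * n) ` {s..<s + m}"
      by (simp add: image_add_atLeastLessThan' add_ac)
    then show "circle_point n ` {s + 2 * n..<s + 2 * n + m} = circle_point n ` {s..<s + m}"
      by (simp only: image_image circle_point_add_modulus)
  qed
  then show ?thesis using that[of "s + 2 * n"] assms by simp
qed

text \<open>By induction the tail empties an arc. If the head were an interior point of the larger
  arc, then the start \<open>s\<close> of that arc and the successor of the head would both be
  starts of the tail's arc, against \<open>arc_start_unique\<close>.\<close>

lemma arc_listsI:
  assumes "0 < n" "length xs < 2 * n" "distinct xs"
    and "\<And>j. j < length xs \<Longrightarrow> circle_interval n (set (drop j xs))"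
  shows "\<exists>a. xs \<in> arc_lists n a (length xs)"
  using assms
proof (induction xs)
  case (Cons x xs)
  have "\<exists>a. xs \<in> arc_lists n a (length xs)"
    using Cons.prems(1,2,3) Cons.prems(4)[of "Suc _"] by (intro Cons.IH) auto
  then obtain a where a: "xs \<in> arc_lists n a (length xs)" ..
  define m where "m = length xs"
  have m: "Suc m < 2 * n" using Cons.prems by (simp add: m_def)
  have "card (set (x # xs)) = Suc m"
    using distinct_card[OF Cons.prems(3)] by (simp add: m_def)
  then obtain s where s: "set (x # xs) = circle_point n ` {s..<s + Suc m}" "0 < s"
    using interval_card_bounded[OF Cons.prems(1) _ _ m, of "set (x # xs)"] Cons.prems(4)[of 0]
    by (metis drop0 length_greater_0_conv list.distinct(1))
  have inj: "inj_on (circle_point n) {s..<s + Suc m}"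
    using Cons.prems(1) m by (intro inj_on_circle_point) auto
  obtain i where i: "i \<le> m" "x = circle_point n (s + i)"
  proof -
    have "x \<in> circle_point n ` {s..<s + Suc m}" using s by auto
    then obtain k where "k \<in> {s..<s + Suc m}" "x = circle_point n k" by auto
    then show ?thesis using that[of "k - s"] by auto
  qed
  have "set xs = set (x # xs) - {x}" using Cons.prems by auto
  also have "\<dots> = circle_point n ` ({s..<s + Suc m} - {s + i})"
    unfolding s(1) using inj_on_image_set_diff[OF inj, of "{s..<s + Suc m}" "{s + i}"] i by simp
  finally have set_xs: "circle_point n ` {a..<a + m} = circle_point n ` ({s..<s + Suc m} - {s + i})"
    using arc_lists_set[OF a] by (simp add: m_def)
  have pred: "circle_point n (s - 1) \<notin> set (x # xs)"
  proof -
    have "inj_on (circle_point n) {s - 1..<s - 1 + Suc (Suc m)}"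
      using Cons.prems(1) m by (intro inj_on_circle_point) auto
    then show ?thesis unfolding s using \<open>0 < s\<close>
      by (subst inj_on_image_mem_iff) auto
  qed
  have start_s: "s mod (2 * n) = a mod (2 * n)" if "0 < i"
  proof (rule arc_start_unique)
    show "circle_point n s \<in> circle_point n ` {a..<a + m}"
      unfolding set_xs using that i by auto
    show "circle_point n (s - 1) \<notin> circle_point n ` {a..<a + m}"
      using pred unfolding s set_xs by auto
  qed (use Cons.prems m s in auto)
  have start_i: "(s + i + 1) mod (2 * n) = a mod (2 * n)" if "i < m"
  proof (rule arc_start_unique)
    show "circle_point n (s + i + 1) \<in> circle_point n ` {a..<a + m}"
      unfolding set_xs using that i by auto
    show "circle_point n (s + i + 1 - 1) \<notin> circle_point n ` {a..<a + m}"
      unfolding set_xs using inj that by (subst inj_on_image_mem_iff) auto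
  qed (use Cons.prems m s in auto)
  consider "i = m" "0 < i" | "i = 0" "0 < m" | "m = 0" | "0 < i" "i < m" using i by linarith
  then show ?case
  proof cases
    case 1
    then have "xs \<in> arc_lists n s m"
      using arc_lists_cong[OF Cons.prems(1) start_s] a by (simp add: m_def)
    then show ?thesis using 1 i by (auto simp: m_def intro!: exI[of _ s])
  next
    case 2
    then have "xs \<in> arc_lists n (s + 1) m"
      using arc_lists_cong[OF Cons.prems(1) start_i] a by (simp add: m_def)
    then show ?thesis using 2 i by (auto simp: m_def intro!: exI[of _ s])
  next
    case 3
    then show ?thesis using i by (auto simp: m_def intro!: exI[of _ s])
  next
    \<comment> \<open>The two starts coincide only if \<open>2 * n\<close> divides
      \<open>i + 1\<close>, but \<open>i + 1\<close> is at most \<open>m\<close>, which is below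
      \<open>2 * n\<close>.\<close>
    case 4
    then have "s mod (2 * n) = (s + i + 1) mod (2 * n)" using start_s start_i by simp
    then have "2 * n dvd (s + i + 1) - s"
      using mod_eq_dvd_iff_nat[of s "s + i + 1" "2 * n"] by simp
    then have "2 * n dvd i + 1" by simp
    then show ?thesis using 4 m dvd_imp_le[of "2 * n" "i + 1"] by simp
  qed
qed simp

text \<open>A proper nonempty arc determines its start, so the sum over all lists splits according
  to the start.\<close>

lemma arc_lists_disjoint:
  assumes "0 < n" "0 < m" "m < 2 * n" "a \<in> {1..2 * n}" "b \<in> {1..2 * n}" "a \<noteq> b"
  shows "arc_lists n a m \<inter> arc_lists n b m = {}"
proof (rule ccontr)
  assume "arc_lists n a m \<inter> arc_lists n b m \<noteq> {}"
  then have eq: "circle_point n ` {a..<a + m} = circle_point n ` {b..<b + m}"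
    using arc_lists_set by blast
  have "b mod (2 * n) = a mod (2 * n)"
  proof (rule arc_start_unique)
    show "circle_point n b \<in> circle_point n ` {a..<a + m}"
      unfolding eq using assms by auto
    have "inj_on (circle_point n) {b - 1..<b - 1 + Suc m}"
      using assms by (intro inj_on_circle_point) auto
    then show "circle_point n (b - 1) \<notin> circle_point n ` {a..<a + m}"
      unfolding eq using assms by (subst inj_on_image_mem_iff) auto
  qed (use assms in auto)
  then show False
    using assms by (cases "a = 2 * n"; cases "b = 2 * n") auto
qed

section \<open>Correspondence between \<open>B\<close>-arc permutations and arc lists\<close>

definition window :: "nat \<Rightarrow> (int \<Rightarrow> int) \<Rightarrow> int list" where
  "window n \<pi> = map (\<lambda>i. \<pi> (int (Suc i))) [0..<n]"

lemma length_window [simp]: "length (window n \<pi>) = n"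
  by (simp add: window_def)

lemma nth_window [simp]: "i < n \<Longrightarrow> window n \<pi> ! i = \<pi> (int (Suc i))"
  by (simp add: window_def)

lemma set_drop_window: "set (drop j (window n \<pi>)) = \<pi> ` {int (Suc j)..int n}"
proof -
  have "(\<lambda>i. int (Suc i)) ` {j..<n} = {int (Suc j)..int n}"
  proof (intro equalityI subsetI)
    fix x assume "x \<in> {int (Suc j)..int n}"
    then have "x = int (Suc (nat x - 1))" "nat x - 1 \<in> {j..<n}" by auto
    then show "x \<in> (\<lambda>i. int (Suc i)) ` {j..<n}" by blast
  qed auto
  then have "\<pi> ` {int (Suc j)..int n} = (\<lambda>i. \<pi> (int (Suc i))) ` {j..<n}"
    by (metis image_image)
  then show ?thesis by (simp add: window_def drop_map)
qed

text \<open>The window fixes the values at positive points, oddness those at negative points, and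
  all other integers are fixed points.\<close>

lemma inj_on_window: "inj_on (window n) (B_group n)"
proof (rule inj_onI)
  fix \<pi> \<sigma> assume *: "\<pi> \<in> B_group n" "\<sigma> \<in> B_group n" "window n \<pi> = window n \<sigma>"
  have pos: "\<pi> x = \<sigma> x" if "1 \<le> x" "x \<le> int n" for x
  proof -
    have "nat x - 1 < n" "int (Suc (nat x - 1)) = x" using that by auto
    then show ?thesis using *(3) nth_window by metis
  qed
  show "\<pi> = \<sigma>"
  proof
    fix x
    consider "1 \<le> x" "x \<le> int n" | "1 \<le> - x" "- x \<le> int n" | "x \<notin> signed_points n"
      by (force simp: signed_points_def)
    then show "\<pi> x = \<sigma> x"
    proof cases
      case 2
      then have "x \<in> signed_points n" by (auto simp: signed_points_def)
      then have "\<pi> (- x) = - \<pi> x" "\<sigma> (- x) = - \<sigma> x" using * by (auto simp: B_group_def)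
      then show ?thesis using pos[of "- x"] 2 by simp
    next
      case 3
      then show ?thesis using * by (auto simp: B_group_def permutes_def)
    qed (rule pos)
  qed
qed

lemma window_arc_list:
  assumes "0 < n" "\<pi> \<in> B_arc_permutations n"
  shows "\<exists>a\<in>{1..2 * n}. window n \<pi> \<in> arc_lists n a n"
proof -
  have perm: "\<pi> permutes signed_points n" using assms by (auto simp: B_arc_permutations_def B_group_def)
  have "distinct (window n \<pi>)"
    by (simp add: window_def distinct_map inj_on_def inj_eq[OF permutes_inj[OF perm]])
  moreover have "circle_interval n (set (drop j (window n \<pi>)))" if "j < n" for j
    using assms(2) that unfolding set_drop_window B_arc_permutations_def
    by (auto dest!: bspec[of _ _ "Suc j"])
  ultimately obtain a where a: "window n \<pi> \<in> arc_lists n a n"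
    using arc_listsI[of n "window n \<pi>"] assms(1) by auto
  \<comment> \<open>The representative \<open>2 * n\<close> replaces \<open>0\<close>, so that the
    arc of all negative points joins the starts \<open>n..2 * n\<close>, which are later treated as
    two blocks.\<close>
  define b where "b = (if a mod (2 * n) = 0 then 2 * n else a mod (2 * n))"
  have b: "b \<in> {1..2 * n}"
    using assms(1) mod_less_divisor[of "2 * n" a] by (auto simp: b_def)
  have "a mod (2 * n) = b mod (2 * n)" by (simp add: b_def)
  then show ?thesis using arc_lists_cong[OF assms(1)] a b by blast
qed

text \<open>Since \<open>n\<close> consecutive points contain no opposite pair, the odd extension of
  the list is injective on the finite set of signed points, hence a permutation of it.\<close>

lemma arc_list_window:
  assumes "0 < n" "xs \<in> arc_lists n a n"
  shows "\<exists>\<pi>\<in>B_arc_permutations n. window n \<pi> = xs"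
proof -
  let ?S = "signed_points n"
  define \<pi> where "\<pi> x = (if 1 \<le> x \<and> x \<le> int n then xs ! (nat x - 1)
    else if 1 \<le> - x \<and> - x \<le> int n then - xs ! (nat (- x) - 1) else x)" for x
  have len: "length xs = n" using assms arc_lists_length by blast
  have set_xs: "set xs = circle_point n ` {a..<a + n}" using assms arc_lists_set by blast
  have dist: "distinct xs" using assms arc_lists_distinct by simp
  have not_opposite: "xs ! i \<noteq> - xs ! j" if "i < n" "j < n" for i j
  proof
    assume eq: "xs ! i = - xs ! j"
    have "xs ! i \<in> circle_point n ` {a..<a + n}" "xs ! j \<in> circle_point n ` {a..<a + n}"
      unfolding set_xs[symmetric] using that len by auto
    then obtain k l where k: "k \<in> {a..<a + n}" "xs ! i = circle_point n k"
      and l: "l \<in> {a..<a + n}" "xs ! j = circle_point n l" by auto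
    then have "circle_point n k = circle_point n (l + n)"
      using eq assms by (simp add: circle_point_add_half)
    moreover have "inj_on (circle_point n) {a..<a + 2 * n}"
      using assms by (intro inj_on_circle_point) auto
    ultimately have "k = l + n" using k l by (auto dest: inj_onD)
    then show False using k l by auto
  qed
  have in_S: "xs ! i \<in> ?S" if "i < n" for i
  proof -
    have "xs ! i \<in> circle_point n ` {a..<a + n}"
      unfolding set_xs[symmetric] using that len by auto
    then show ?thesis using circle_point_in_signed_points[OF assms(1)] by auto
  qed
  have neg_S: "- x \<in> ?S \<longleftrightarrow> x \<in> ?S" for x by (auto simp: signed_points_def)
  have cases_S: "(1 \<le> x \<and> x \<le> int n) \<or> (1 \<le> - x \<and> - x \<le> int n)" if "x \<in> ?S" for x
    using that by (auto simp: signed_points_def)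
  have "nat (1 + int i) = Suc i" for i by simp
  then have win: "window n \<pi> = xs"
    by (intro nth_equalityI) (auto simp: len \<pi>_def)
  have odd: "\<pi> (- x) = - \<pi> x" for x by (auto simp: \<pi>_def)
  have img: "\<pi> ` ?S \<subseteq> ?S"
    by (auto dest!: cases_S simp: \<pi>_def neg_S intro!: in_S)
  have inj: "inj_on \<pi> ?S"
  proof (rule inj_onI)
    fix x y assume "x \<in> ?S" "y \<in> ?S" and eq: "\<pi> x = \<pi> y"
    have idx: "nat x - 1 = nat y - 1 \<Longrightarrow> 1 \<le> x \<Longrightarrow> 1 \<le> y \<Longrightarrow> x = y" for x y :: int by linarith
    from cases_S[OF \<open>x \<in> ?S\<close>] cases_S[OF \<open>y \<in> ?S\<close>] show "x = y"
    proof (elim disjE conjE)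
      assume "1 \<le> x" "x \<le> int n" "1 \<le> y" "y \<le> int n"
      then show ?thesis using eq nth_eq_iff_index_eq[OF dist, of "nat x - 1" "nat y - 1"] len
        by (intro idx) (auto simp: \<pi>_def)
    next
      assume *: "1 \<le> - x" "- x \<le> int n" "1 \<le> - y" "- y \<le> int n"
      then have "- x = - y" using eq nth_eq_iff_index_eq[OF dist, of "nat (- x) - 1" "nat (- y) - 1"] len
        by (intro idx) (auto simp: \<pi>_def)
      then show ?thesis by simp
    next
      assume *: "1 \<le> x" "x \<le> int n" "1 \<le> - y" "- y \<le> int n"
      then have "nat x - 1 < n" "nat (- y) - 1 < n" by linarith+
      then show ?thesis using * eq not_opposite[of "nat x - 1" "nat (- y) - 1"]
        by (auto simp: \<pi>_def)
    next
      assume *: "1 \<le> - x" "- x \<le> int n" "1 \<le> y" "y \<le> int n"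
      then have "nat y - 1 < n" "nat (- x) - 1 < n" by linarith+
      then show ?thesis using * eq not_opposite[of "nat y - 1" "nat (- x) - 1"]
        by (auto simp: \<pi>_def)
    qed
  qed
  have "\<pi> ` ?S = ?S"
    using img inj by (intro endo_inj_surj) (auto simp: signed_points_def)
  then have "bij_betw \<pi> ?S ?S" using inj by (simp add: bij_betw_def)
  then have "\<pi> permutes ?S"
    by (rule bij_imp_permutes) (auto simp: \<pi>_def signed_points_def)
  then have "\<pi> \<in> B_group n" using odd by (simp add: B_group_def)
  moreover have "circle_interval n (\<pi> ` {int j..int n})" if "j \<in> {1..n}" for j
    using arc_lists_suffix_interval[OF assms(2), of "j - 1"] that
    by (simp add: set_drop_window flip: win)
  ultimately show ?thesis using win by (auto simp: B_arc_permutations_def)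
qed

lemma bij_betw_window:
  assumes "0 < n"
  shows "bij_betw (window n) (B_arc_permutations n) (\<Union>a\<in>{1..2 * n}. arc_lists n a n)"
  unfolding bij_betw_def
proof (intro conjI equalityI subsetI)
  show "inj_on (window n) (B_arc_permutations n)"
    by (rule inj_on_subset[OF inj_on_window]) (auto simp: B_arc_permutations_def)
next
  fix xs assume "xs \<in> window n ` B_arc_permutations n"
  then show "xs \<in> (\<Union>a\<in>{1..2 * n}. arc_lists n a n)"
    using window_arc_list[OF assms] by auto
next
  fix xs assume "xs \<in> (\<Union>a\<in>{1..2 * n}. arc_lists n a n)"
  then show "xs \<in> window n ` B_arc_permutations n"
    using arc_list_window[OF assms] by blast
qed

section \<open>Descent weights and the statistics\<close>

text \<open>The list \<open>xs\<close> is what remains after \<open>i\<close> entries, so its first descent position is \<open>i + 1\<close>. The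
  factor \<open>y i\<close> of \<open>signed_weight\<close> stands for a descent at \<open>i\<close>; with \<open>y 0 = t\<close> it also encodes the
  contribution of \<open>\<pi>(1) < 0\<close> to \<open>fdes\<close>.\<close>
fun desc_weight :: "(nat \<Rightarrow> 'a :: comm_ring_1) \<Rightarrow> nat \<Rightarrow> int list \<Rightarrow> 'a" where
  "desc_weight y i (x # z # zs) =
     (if B_less z x then y (Suc i) else 1) * desc_weight y (Suc i) (z # zs)"
| "desc_weight y i _ = 1"

definition signed_weight :: "(nat \<Rightarrow> 'a :: comm_ring_1) \<Rightarrow> nat \<Rightarrow> int list \<Rightarrow> 'a" where
  "signed_weight y i xs = (if hd xs < 0 then y i else 1) * desc_weight y i xs"

lemma desc_weight_Cons:
  "xs \<noteq> [] \<Longrightarrow> desc_weight y i (x # xs) =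
    (if B_less (hd xs) x then y (Suc i) else 1) * desc_weight y (Suc i) xs"
  by (cases xs) auto

lemma prod_head_shift:
  assumes "0 < m"
  shows "(\<Prod>j\<in>{1..<Suc m}. f j) = f 1 * (\<Prod>j\<in>{1..<m}. f (Suc j))"
proof -
  have "{1..<Suc m} = insert 1 (Suc ` {1..<m})"
    using assms by (auto simp: image_Suc_atLeastLessThan)
  then have "(\<Prod>j\<in>{1..<Suc m}. f j) = f 1 * (\<Prod>j\<in>Suc ` {1..<m}. f j)"
    by (simp only:) (rule prod.insert, auto)
  then show ?thesis by (simp add: prod.reindex del: image_Suc_atLeastLessThan)
qed

text \<open>The recursion suits the inductions on arcs; this product form is the one to compare with
  \<open>Des\<close>.\<close>

lemma desc_weight_eq_prod:
  "desc_weight y i xs =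
    (\<Prod>j\<in>{1..<length xs}. if B_less (xs ! j) (xs ! (j - 1)) then y (i + j) else 1)"
proof (induction y i xs rule: desc_weight.induct)
  case (1 y i x z zs)
  let ?f = "\<lambda>i xs j. if B_less (xs ! j) (xs ! (j - 1)) then y (i + j) else 1"
  have "(\<Prod>j\<in>{1..<length (x # z # zs)}. ?f i (x # z # zs) j) =
      ?f i (x # z # zs) 1 * (\<Prod>j\<in>{1..<length (z # zs)}. ?f i (x # z # zs) (Suc j))"
    unfolding length_Cons[of x] by (rule prod_head_shift) simp
  also have "(\<Prod>j\<in>{1..<length (z # zs)}. ?f i (x # z # zs) (Suc j)) =
      (\<Prod>j\<in>{1..<length (z # zs)}. ?f (Suc i) (z # zs) j)"
    by (rule prod.cong) (auto simp: nth_Cons')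
  finally show ?case using 1 by simp
qed auto

text \<open>A descent at \<open>i\<close> adds 2 to \<open>fdes\<close> and \<open>2 * i\<close> to
  \<open>fmaj\<close>. The factor for \<open>neg\<close> stays apart because it is constant on the
  lists of one arc.\<close>

lemma statistics_weight:
  fixes t q :: "'a :: comm_ring_1"
  assumes "0 < n" and y: "y 0 = t" "\<And>i. 0 < i \<Longrightarrow> y i = t ^ 2 * q ^ (2 * i)"
  shows "t ^ fdes n \<pi> * q ^ fmaj n \<pi> =
    q ^ length (filter (\<lambda>x. x < 0) (window n \<pi>)) * signed_weight y 0 (window n \<pi>)"
proof -
  have Des: "Des n \<pi> = {j \<in> {1..<n}. B_less (window n \<pi> ! j) (window n \<pi> ! (j - 1))}"
    by (auto simp: Des_def)
  have "desc_weight y 0 (window n \<pi>) = (\<Prod>j\<in>Des n \<pi>. y j)"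
    unfolding desc_weight_eq_prod Des by (subst prod.inter_filter) (auto intro!: prod.cong)
  also have "\<dots> = (\<Prod>j\<in>Des n \<pi>. t ^ 2 * q ^ (2 * j))"
    by (intro prod.cong) (auto simp: Des y)
  also have "\<dots> = t ^ (2 * des n \<pi>) * q ^ (2 * maj n \<pi>)"
    by (simp add: prod.distrib des_def maj_def power_mult power_sum)
  finally have "desc_weight y 0 (window n \<pi>) = t ^ (2 * des n \<pi>) * q ^ (2 * maj n \<pi>)" .
  moreover have "hd (window n \<pi>) = \<pi> 1"
    using assms by (simp add: hd_conv_nth flip: length_greater_0_conv)
  moreover have "length (filter (\<lambda>x. x < 0) (window n \<pi>)) = neg n \<pi>"
  proof -
    have "{i \<in> {1..n}. \<pi> (int i) < 0} = Suc ` {i. i < n \<and> \<pi> (int (Suc i)) < 0}"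
    proof (intro equalityI subsetI)
      fix x assume "x \<in> {i \<in> {1..n}. \<pi> (int i) < 0}"
      then show "x \<in> Suc ` {i. i < n \<and> \<pi> (int (Suc i)) < 0}"
        by (intro image_eqI[of _ _ "x - 1"]) auto
    qed auto
    moreover have "{i. i < n \<and> window n \<pi> ! i < 0} = {i. i < n \<and> \<pi> (int (Suc i)) < 0}"
      by auto
    ultimately show ?thesis by (simp add: neg_def length_filter_conv_card card_image)
  qed
  ultimately show ?thesis
    by (simp add: signed_weight_def fdes_def fmaj_def y power_add algebra_simps)
qed

section \<open>Weight sums over the lists of one arc\<close>

text \<open>With \<open>0 < m\<close> the two end points differ, so the two branches of the
  recursion are disjoint.\<close>

lemma sum_arc_lists_Suc:
  fixes f :: "int list \<Rightarrow> 'a :: comm_monoid_add"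
  assumes "0 < n" "0 < m" "Suc m \<le> 2 * n"
  shows "(\<Sum>xs\<in>arc_lists n a (Suc m). f xs) =
    (\<Sum>xs\<in>arc_lists n (a + 1) m. f (circle_point n a # xs)) +
    (\<Sum>xs\<in>arc_lists n a m. f (circle_point n (a + m) # xs))"
proof -
  have "inj_on (circle_point n) {a..<a + Suc m}"
    using assms by (intro inj_on_circle_point) auto
  then have "circle_point n a \<noteq> circle_point n (a + m)"
    using assms by (auto dest: inj_onD)
  then have "(\<Sum>xs\<in>arc_lists n a (Suc m). f xs) =
      (\<Sum>xs\<in>(#) (circle_point n a) ` arc_lists n (a + 1) m. f xs) +
      (\<Sum>xs\<in>(#) (circle_point n (a + m)) ` arc_lists n a m. f xs)"
    unfolding arc_lists.simps by (intro sum.union_disjoint) auto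
  then show ?thesis by (simp add: sum.reindex)
qed

lemma arc_list_hd:
  assumes "xs \<in> arc_lists n a m" "0 < m"
  obtains r where "a \<le> r" "r < a + m" "hd xs = circle_point n r" "xs \<noteq> []"
proof -
  have "xs \<noteq> []" using arc_lists_length[OF assms(1)] assms(2) by auto
  then have "hd xs \<in> circle_point n ` {a..<a + m}"
    using arc_lists_set[OF assms(1)] hd_in_set[of xs] by simp
  then show ?thesis using that \<open>xs \<noteq> []\<close> by auto
qed

text \<open>The left end lies below and the right end above everything that remains. Each deletion
  except the last therefore contributes 1 or the next \<open>y\<close>, whatever entry
  follows.\<close>

lemma sum_desc_weight_unbroken:
  assumes "0 < m" "a + m \<le> 2 * n"
  shows "(\<Sum>xs\<in>arc_lists n a m. desc_weight y i xs) = (\<Prod>j\<in>{1..<m}. 1 + y (i + j))"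
  using assms
proof (induction m arbitrary: a i)
  case (Suc m)
  show ?case
  proof (cases "m = 0")
    case False
    have n: "0 < n" using Suc.prems by simp
    have asc: "desc_weight y i (circle_point n a # xs) = desc_weight y (Suc i) xs"
      if xs: "xs \<in> arc_lists n (a + 1) m" for xs
    proof -
      from xs False obtain r where "a + 1 \<le> r" "r < a + 1 + m" "hd xs = circle_point n r" "xs \<noteq> []"
        by (auto elim: arc_list_hd)
      then show ?thesis using Suc.prems by (simp add: desc_weight_Cons B_less_circle_point)
    qed
    have desc: "desc_weight y i (circle_point n (a + m) # xs) = y (Suc i) * desc_weight y (Suc i) xs"
      if xs: "xs \<in> arc_lists n a m" for xs
    proof -
      from xs False obtain r where "a \<le> r" "r < a + m" "hd xs = circle_point n r" "xs \<noteq> []"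
        by (auto elim: arc_list_hd)
      then show ?thesis using Suc.prems by (simp add: desc_weight_Cons B_less_circle_point)
    qed
    have "(\<Sum>xs\<in>arc_lists n a (Suc m). desc_weight y i xs) =
        (1 + y (Suc i)) * (\<Prod>j\<in>{1..<m}. 1 + y (Suc i + j))"
      using False Suc.prems Suc.IH[of "a + 1" "Suc i"] Suc.IH[of a "Suc i"] n
      by (simp add: sum_arc_lists_Suc asc[simplified] desc distrib_right
          flip: sum_distrib_left del: arc_lists.simps)
    also have "\<dots> = (\<Prod>j\<in>{1..<Suc m}. 1 + y (i + j))"
      using prod_head_shift[of m "\<lambda>j. 1 + y (i + j)"] False by simp
    finally show ?thesis .
  qed simp
qed simp

text \<open>The arc of length \<open>h + k\<close> that starts at \<open>2n - h\<close> consists of the \<open>h\<close> largest and the \<open>k\<close>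
  smallest points.\<close>
definition broken_weight ::
    "nat \<Rightarrow> (nat \<Rightarrow> 'a :: comm_ring_1) \<Rightarrow> nat \<Rightarrow> nat \<Rightarrow> nat \<Rightarrow> 'a" where
  "broken_weight n y i h k = (\<Sum>xs\<in>arc_lists n (2 * n - h) (h + k). signed_weight y i xs)"

text \<open>Only positive points are left: the arc is unbroken and the sign factor is 1.\<close>

lemma broken_weight_0_right:
  assumes "0 < h" "h \<le> n"
  shows "broken_weight n y i h 0 = (\<Prod>j\<in>{1..<h}. 1 + y (i + j))"
proof -
  have "signed_weight y i xs = desc_weight y i xs" if "xs \<in> arc_lists n (2 * n - h) h" for xs
  proof -
    from that assms(1) obtain r where "2 * n - h \<le> r" "r < 2 * n - h + h" "hd xs = circle_point n r"
      by (auto elim: arc_list_hd)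
    moreover from this have "\<not> r < n" using assms by simp
    ultimately show ?thesis using assms by (simp add: signed_weight_def circle_point_neg_iff)
  qed
  then show ?thesis
    using assms by (simp add: broken_weight_def sum_desc_weight_unbroken)
qed

text \<open>Only negative points are left: the start \<open>2 * n\<close> can be moved to
  \<open>0\<close>, where the arc is unbroken, and the sign factor is \<open>y i\<close>.\<close>

lemma broken_weight_0_left:
  assumes "0 < k" "k \<le> n"
  shows "broken_weight n y i 0 k = y i * (\<Prod>j\<in>{1..<k}. 1 + y (i + j))"
proof -
  have "arc_lists n (2 * n) k = arc_lists n 0 k"
    using assms by (intro arc_lists_cong) auto
  moreover have "signed_weight y i xs = y i * desc_weight y i xs" if "xs \<in> arc_lists n 0 k" for xs
  proof -
    from that assms(1) obtain r where "r < 0 + k" "hd xs = circle_point n r"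
      by (auto elim: arc_list_hd)
    then show ?thesis using assms by (simp add: signed_weight_def circle_point_neg_iff)
  qed
  ultimately show ?thesis
    using assms by (simp add: broken_weight_def sum_desc_weight_unbroken flip: sum_distrib_left)
qed

text \<open>While both blocks are nonempty, position \<open>i + 1\<close> is a descent exactly if the entry after it
  is negative, whichever end was removed; this makes \<open>signed_weight\<close> multiplicative.\<close>
lemma broken_weight_Suc_Suc:
  assumes "Suc h + Suc k \<le> n"
  shows "broken_weight n y i (Suc h) (Suc k) =
    broken_weight n y (Suc i) h (Suc k) + y i * broken_weight n y (Suc i) (Suc h) k"
proof -
  define a where "a = 2 * n - Suc h"
  define m where "m = Suc (h + k)"
  have n: "0 < n" using assms by simp
  have bounds: "n \<le> a" "a < 2 * n" "a + 1 = 2 * n - h" "a + m = 2 * n + k" "k < n" "0 < m" "Suc m \<le> 2 * n"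
    using assms by (auto simp: a_def m_def)
  have neg_iff: "circle_point n r < 0 \<longleftrightarrow> 2 * n \<le> r" if "a \<le> r" "r \<le> a + m" for r
    using that bounds by (auto simp: circle_point_neg_iff mod_if)
  have left: "signed_weight y i (circle_point n a # xs) = signed_weight y (Suc i) xs"
    if xs: "xs \<in> arc_lists n (a + 1) m" for xs
  proof -
    from xs bounds obtain r where r: "a + 1 \<le> r" "r < a + 1 + m" "hd xs = circle_point n r" "xs \<noteq> []"
      by (auto elim: arc_list_hd)
    \<comment> \<open>The point at \<open>a\<close> is the smallest positive one of the arc, so only
      negative points lie below it.\<close>
    have "B_less (circle_point n r) (circle_point n a) \<longleftrightarrow> 2 * n \<le> r"
      using r n bounds by (auto simp: B_less_circle_point mod_if)
    then show ?thesis
      using r neg_iff[of a] neg_iff[of r] bounds by (simp add: signed_weight_def desc_weight_Cons)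
  qed
  have right: "signed_weight y i (circle_point n (a + m) # xs) = y i * signed_weight y (Suc i) xs"
    if xs: "xs \<in> arc_lists n a m" for xs
  proof -
    from xs bounds obtain r where r: "a \<le> r" "r < a + m" "hd xs = circle_point n r" "xs \<noteq> []"
      by (auto elim: arc_list_hd)
    \<comment> \<open>The point at \<open>a + m\<close> is the largest negative one of the arc, so
      all other negative points lie below it and all positive ones above.\<close>
    have "B_less (circle_point n r) (circle_point n (a + m)) \<longleftrightarrow> 2 * n \<le> r"
      using r n bounds by (auto simp: B_less_circle_point mod_if)
    then show ?thesis
      using r neg_iff[of "a + m"] neg_iff[of r] bounds
      by (simp add: signed_weight_def desc_weight_Cons)
  qed
  have "broken_weight n y i (Suc h) (Suc k) = (\<Sum>xs\<in>arc_lists n a (Suc m). signed_weight y i xs)"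
    by (simp add: broken_weight_def a_def m_def del: arc_lists.simps)
  also have "\<dots> = (\<Sum>xs\<in>arc_lists n (a + 1) m. signed_weight y (Suc i) xs) +
      y i * (\<Sum>xs\<in>arc_lists n a m. signed_weight y (Suc i) xs)"
    unfolding sum_arc_lists_Suc[OF n bounds(6,7)] sum_distrib_left
    by (intro arg_cong2[of _ _ _ _ plus] sum.cong left right refl)
  finally show ?thesis
    using bounds(3) by (simp add: broken_weight_def a_def m_def del: arc_lists.simps)
qed

text \<open>For \<open>a < n\<close> the negative points are those from \<open>a\<close> to
  \<open>n - 1\<close>; otherwise they are the ones reached after passing
  \<open>2n - 1\<close>.\<close>

lemma arc_lists_neg:
  assumes "xs \<in> arc_lists n a n" "1 \<le> a" "a \<le> 2 * n"
  shows "length (filter (\<lambda>x. x < 0) xs) = (if a < n then n - a else a - n)"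
proof -
  have "length (filter (\<lambda>x. x < 0) xs) = size (filter_mset (\<lambda>x. x < 0) (mset xs))"
    by (simp flip: mset_filter)
  also have "\<dots> = size (filter_mset (\<lambda>x. x < 0) (mset (map (circle_point n) [a..<a + n])))"
    using arc_lists_mset[OF assms(1)] by simp
  also have "\<dots> = length (filter (\<lambda>r. circle_point n r < 0) [a..<a + n])"
    by (simp only: mset_filter[symmetric] size_mset filter_map length_map comp_def)
  also have "\<dots> = card {r \<in> {a..<a + n}. circle_point n r < 0}"
    using distinct_card[of "filter (\<lambda>r. circle_point n r < 0) [a..<a + n]"] by simp
  also have "{r \<in> {a..<a + n}. circle_point n r < 0} = (if a < n then {a..<n} else {2 * n..<a + n})"
  proof -
    have "circle_point n r < 0 \<longleftrightarrow> r < n \<or> 2 * n \<le> r" if "r < a + n" for r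
    proof (cases "r < 2 * n")
      case False
      then have "r mod (2 * n) = r - 2 * n" using assms that by (simp add: le_mod_geq)
      then show ?thesis using False that assms by (simp add: circle_point_neg_iff)
    qed (simp add: circle_point_neg_iff)
    then show ?thesis using assms by auto
  qed
  finally show ?thesis by auto
qed

text \<open>The left end is negative and the right end positive. Deleting the left end first costs
  \<open>y 0\<close> for the sign and no descent; deleting the right end first costs
  \<open>y 1\<close> for a descent and no sign. An unbroken arc remains.\<close>

lemma sum_signed_weight_mixed:
  assumes "1 \<le> a" "a < n"
  shows "(\<Sum>xs\<in>arc_lists n a n. signed_weight y 0 xs) =
    (y 0 + y 1) * (\<Prod>j\<in>{1..<n - 1}. 1 + y (1 + j))"
proof -
  obtain m where m: "n = Suc m" "0 < m" using assms by (cases n) auto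
  have left: "signed_weight y 0 (circle_point n a # xs) = y 0 * desc_weight y 1 xs"
    if xs: "xs \<in> arc_lists n (a + 1) m" for xs
  proof -
    from xs m obtain r where "a + 1 \<le> r" "r < a + 1 + m" "hd xs = circle_point n r" "xs \<noteq> []"
      by (auto elim: arc_list_hd)
    then show ?thesis using assms m
      by (simp add: signed_weight_def desc_weight_Cons B_less_circle_point circle_point_neg_iff)
  qed
  have right: "signed_weight y 0 (circle_point n (a + m) # xs) = y 1 * desc_weight y 1 xs"
    if xs: "xs \<in> arc_lists n a m" for xs
  proof -
    from xs m obtain r where "a \<le> r" "r < a + m" "hd xs = circle_point n r" "xs \<noteq> []"
      by (auto elim: arc_list_hd)
    then show ?thesis using assms m
      by (simp add: signed_weight_def desc_weight_Cons B_less_circle_point circle_point_neg_iff)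
  qed
  have "(\<Sum>xs\<in>arc_lists n a n. signed_weight y 0 xs) =
      (\<Sum>xs\<in>arc_lists n a (Suc m). signed_weight y 0 xs)" using m by simp
  also have "\<dots> = y 0 * (\<Sum>xs\<in>arc_lists n (a + 1) m. desc_weight y 1 xs) +
      y 1 * (\<Sum>xs\<in>arc_lists n a m. desc_weight y 1 xs)"
    using m(2) assms unfolding m(1) sum_distrib_left
    by (subst sum_arc_lists_Suc)
      (auto intro!: arg_cong2[of _ _ _ _ plus] sum.cong left[unfolded m(1)] right[unfolded m(1)]
        simp del: One_nat_def)
  finally show ?thesis
    using m assms by (simp add: sum_desc_weight_unbroken distrib_right)
qed

section \<open>The recursion for broken arcs and its solution\<close>

text \<open>The power of \<open>q\<close> records the \<open>k\<close> negative points, that is, the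
  contribution of \<open>neg\<close> to \<open>fmaj\<close>.\<close>

definition broken_total ::
    "nat \<Rightarrow> (nat \<Rightarrow> 'a :: comm_ring_1) \<Rightarrow> 'a \<Rightarrow> nat \<Rightarrow> nat \<Rightarrow> 'a" where
  "broken_total n y q i m = (\<Sum>k\<le>m. q ^ k * broken_weight n y i (m - k) k)"

text \<open>Starts \<open>a = n + k\<close> with \<open>k \<le> n\<close> give the arcs with
  \<open>n - k\<close> positive and \<open>k\<close> negative points of the broken type. The starts
  below \<open>n\<close> all have the same signed sum and differ only in the power of
  \<open>q\<close>.\<close>

lemma sum_B_arc_permutations:
  fixes t q :: "'a :: comm_ring_1"
  assumes "2 \<le> n" and y: "y 0 = t" "\<And>i. 0 < i \<Longrightarrow> y i = t ^ 2 * q ^ (2 * i)"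
  shows "(\<Sum>\<pi>\<in>B_arc_permutations n. t ^ fdes n \<pi> * q ^ fmaj n \<pi>) =
    broken_total n y q 0 n +
    (\<Sum>k\<in>{1..<n}. q ^ k) * ((y 0 + y 1) * (\<Prod>j\<in>{1..<n - 1}. 1 + y (1 + j)))"
proof -
  define w where "w xs = q ^ length (filter (\<lambda>x. x < 0) xs) * signed_weight y 0 xs" for xs
  define W where "W a = (\<Sum>xs\<in>arc_lists n a n. w xs)" for a
  have n: "0 < n" using assms by simp
  have W: "W a = q ^ (if a < n then n - a else a - n) * (\<Sum>xs\<in>arc_lists n a n. signed_weight y 0 xs)"
    if "a \<in> {1..2 * n}" for a
    using that unfolding W_def w_def
    by (simp add: arc_lists_neg sum_distrib_left)
  have "(\<Sum>\<pi>\<in>B_arc_permutations n. t ^ fdes n \<pi> * q ^ fmaj n \<pi>) =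
      (\<Sum>\<pi>\<in>B_arc_permutations n. w (window n \<pi>))"
    unfolding w_def using n y by (intro sum.cong statistics_weight) auto
  also have "\<dots> = (\<Sum>xs\<in>(\<Union>a\<in>{1..2 * n}. arc_lists n a n). w xs)"
    by (rule sum.reindex_bij_betw[OF bij_betw_window[OF n]])
  also have "\<dots> = (\<Sum>a\<in>{1..2 * n}. W a)"
    unfolding W_def using n by (intro sum.UNION_disjoint) (auto simp: arc_lists_disjoint)
  also have "{1..2 * n} = {1..<n} \<union> {n..2 * n}" using n by auto
  also have "(\<Sum>a\<in>{1..<n} \<union> {n..2 * n}. W a) = (\<Sum>a\<in>{1..<n}. W a) + (\<Sum>a\<in>{n..2 * n}. W a)"
    by (intro sum.union_disjoint) auto
  also have "(\<Sum>a\<in>{1..<n}. W a) =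
      (\<Sum>a\<in>{1..<n}. q ^ (n - a) * ((y 0 + y 1) * (\<Prod>j\<in>{1..<n - 1}. 1 + y (1 + j))))"
    by (intro sum.cong) (auto simp: W sum_signed_weight_mixed)
  also have "\<dots> = (\<Sum>a\<in>{1..<n}. q ^ (n - a)) * ((y 0 + y 1) * (\<Prod>j\<in>{1..<n - 1}. 1 + y (1 + j)))"
    by (rule sum_distrib_right[symmetric])
  also have "(\<Sum>a\<in>{1..<n}. q ^ (n - a)) = (\<Sum>k\<in>{1..<n}. q ^ k)"
    by (rule sum.reindex_bij_witness[of _ "\<lambda>k. n - k" "\<lambda>k. n - k"]) auto
  also have "(\<Sum>a\<in>{n..2 * n}. W a) = broken_total n y q 0 n"
    unfolding broken_total_def
  proof (rule sum.reindex_bij_witness[of _ "\<lambda>k. n + k" "\<lambda>a. a - n"])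
    fix a assume a: "a \<in> {n..2 * n}"
    then show "q ^ (a - n) * broken_weight n y 0 (n - (a - n)) (a - n) = W a"
      using n by (simp add: W broken_weight_def)
  qed auto
  finally show ?thesis by (simp only: add.commute)
qed

lemma broken_total_1:
  assumes "0 < n"
  shows "broken_total n y q i 1 = 1 + q * y i"
  using assms by (simp add: broken_total_def broken_weight_0_left broken_weight_0_right)

text \<open>Applying \<open>broken_weight_Suc_Suc\<close> to the inner terms yields two sums, each a
  full total of length \<open>m\<close> without one extreme term. These missing terms and the two
  unbroken extremes of length \<open>Suc m\<close> form the inhomogeneous part.\<close>

lemma broken_total_Suc:
  fixes y :: "nat \<Rightarrow> 'a :: comm_ring_1"
  assumes "0 < m" "Suc m \<le> n"
  shows "broken_total n y q i (Suc m) =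
    (1 + q * y i) * broken_total n y q (Suc i) m +
    (y (Suc i) + q ^ Suc m * y i) * (\<Prod>j\<in>{1..<m}. 1 + y (Suc i + j))"
proof -
  let ?U = "broken_weight n y"
  define P where "P = (\<Prod>j\<in>{1..<m}. 1 + y (Suc i + j))"
  define V where "V = broken_total n y q (Suc i) m"
  obtain l where l: "m = Suc l" using assms by (cases m) auto
  have head: "(\<Prod>j\<in>{1..<Suc m}. 1 + y (i + j)) = (1 + y (Suc i)) * P"
    unfolding P_def using assms prod_head_shift[of m "\<lambda>j. 1 + y (i + j)"] by simp
  have U0: "?U i (Suc m) 0 = (1 + y (Suc i)) * P" "?U i 0 (Suc m) = y i * ((1 + y (Suc i)) * P)"
    "?U (Suc i) m 0 = P" "?U (Suc i) 0 m = y (Suc i) * P"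
    using assms head by (simp_all add: broken_weight_0_left broken_weight_0_right P_def)
  have V_left: "V = P + (\<Sum>k\<le>l. q ^ Suc k * ?U (Suc i) (l - k) (Suc k))"
    unfolding V_def broken_total_def l sum.atMost_Suc_shift using U0(3) l by simp
  have V_right: "V = (\<Sum>k\<le>l. q ^ k * ?U (Suc i) (Suc (l - k)) k) + q ^ m * (y (Suc i) * P)"
    unfolding V_def broken_total_def l sum.atMost_Suc using U0(4) l by (simp add: Suc_diff_le)
  have "broken_total n y q i (Suc m) =
      ?U i (Suc m) 0 + (\<Sum>k\<le>m. q ^ Suc k * ?U i (m - k) (Suc k))"
    unfolding broken_total_def sum.atMost_Suc_shift by simp
  also have "(\<Sum>k\<le>m. q ^ Suc k * ?U i (m - k) (Suc k)) =
      (\<Sum>k\<le>l. q ^ Suc k * ?U i (Suc (l - k)) (Suc k)) + q ^ Suc m * ?U i 0 (Suc m)"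
    unfolding l sum.atMost_Suc by (simp add: Suc_diff_le)
  also have "(\<Sum>k\<le>l. q ^ Suc k * ?U i (Suc (l - k)) (Suc k)) =
      (\<Sum>k\<le>l. q ^ Suc k * ?U (Suc i) (l - k) (Suc k)) +
      q * y i * (\<Sum>k\<le>l. q ^ k * ?U (Suc i) (Suc (l - k)) k)"
    unfolding sum_distrib_left sum.distrib[symmetric]
    using assms l by (intro sum.cong) (auto simp: broken_weight_Suc_Suc algebra_simps)
  also have "\<dots> = (V - P) + q * y i * (V - q ^ m * (y (Suc i) * P))"
  proof -
    have "(\<Sum>k\<le>l. q ^ Suc k * ?U (Suc i) (l - k) (Suc k)) = V - P"
      using V_left by simp
    moreover have "(\<Sum>k\<le>l. q ^ k * ?U (Suc i) (Suc (l - k)) k) = V - q ^ m * (y (Suc i) * P)"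
      using V_right by simp
    ultimately show ?thesis by (simp only:)
  qed
  finally show ?thesis
    unfolding U0 P_def[symmetric] V_def[symmetric] by (simp add: algebra_simps)
qed

text \<open>The first product solves the homogeneous recursion, its coefficient depending only on
  \<open>i + m\<close>; the second is a particular solution. The index \<open>0\<close> is excluded
  because \<open>y 0\<close> does not follow the pattern. The factor \<open>1 - q\<close> avoids
  division.\<close>

lemma broken_total_closed_form:
  fixes t q :: "'a :: comm_ring_1"
  assumes y: "\<And>i. 0 < i \<Longrightarrow> y i = t ^ 2 * q ^ (2 * i)"
    and "0 < m" "m \<le> n" "0 < i"
  shows "(1 - q) * broken_total n y q i m =
    (1 - t ^ 2 * q ^ (2 * (i + m))) * (\<Prod>j\<in>{i..<i + m - 1}. 1 + q * y j) -
    (q - t ^ 2 * q ^ (2 * i + m)) * (\<Prod>j\<in>{1..<m}. 1 + y (i + j))"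
  using assms(2-)
proof (induction m arbitrary: i)
  case (Suc m)
  show ?case
  proof (cases "m = 0")
    case True
    have "broken_total n y q i (Suc 0) = 1 + q * y i"
      using broken_total_1[of n y q i] Suc.prems by simp
    then show ?thesis using True Suc.prems y[of i]
      by (simp add: algebra_simps power_add power2_eq_square)
  next
    case False
    let ?P = "\<Prod>j\<in>{1..<m}. 1 + y (Suc i + j)" and ?R = "\<Prod>j\<in>{Suc i..<i + m}. 1 + q * y j"
    have IH: "(1 - q) * broken_total n y q (Suc i) m =
        (1 - t ^ 2 * q ^ (2 * (i + Suc m))) * ?R - (q - t ^ 2 * q ^ (2 * i + m + 2)) * ?P"
      using Suc.IH[of "Suc i"] Suc.prems False by simp
    have R: "(\<Prod>j\<in>{i..<i + Suc m - 1}. 1 + q * y j) = (1 + q * y i) * ?R"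
      using False by (simp add: prod.atLeast_Suc_lessThan)
    have P: "(\<Prod>j\<in>{1..<Suc m}. 1 + y (i + j)) = (1 + y (Suc i)) * ?P"
      using False prod_head_shift[of m "\<lambda>j. 1 + y (i + j)"] by simp
    have "(1 - q) * broken_total n y q i (Suc m) =
        (1 + q * y i) * ((1 - q) * broken_total n y q (Suc i) m) +
        (1 - q) * (y (Suc i) + q ^ Suc m * y i) * ?P"
      using False Suc.prems by (simp add: broken_total_Suc algebra_simps)
    also have "\<dots> = (1 - t ^ 2 * q ^ (2 * (i + Suc m))) * ((1 + q * y i) * ?R) -
        (q - t ^ 2 * q ^ (2 * i + Suc m)) * ((1 + y (Suc i)) * ?P)"
    proof -
      \<comment> \<open>The terms with \<open>?R\<close> already agree; this identity matches the
        coefficients of \<open>?P\<close>.\<close>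
      have "(1 - q) * (y (Suc i) + q ^ Suc m * y i) - (1 + q * y i) * (q - t ^ 2 * q ^ (2 * i + m + 2)) =
          - (q - t ^ 2 * q ^ (2 * i + Suc m)) * (1 + y (Suc i))"
        using Suc.prems y[of i] y[of "Suc i"]
        by (simp add: algebra_simps power_add power_mult power2_eq_square)
      moreover have "Y * (C * R - D * P) + X * P = C * (Y * R) - D' * (Z * P)"
        if "X - Y * D = - D' * Z" for X Y Z C D D' R P :: 'a
      proof -
        have "Y * (C * R - D * P) + X * P = C * (Y * R) + (X - Y * D) * P"
          by (simp add: algebra_simps)
        also have "\<dots> = C * (Y * R) - D' * (Z * P)" unfolding that by (simp add: algebra_simps)
        finally show ?thesis .
      qed
      ultimately show ?thesis unfolding IH by blast
    qed
    finally show ?thesis unfolding R P .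
  qed
qed simp

text \<open>The closed form gives nothing at \<open>q = 1\<close>, so the recursion is solved
  directly. For \<open>m = 0\<close> the truncated exponent \<open>m - 1\<close> is harmless because
  its coefficient vanishes.\<close>

lemma broken_total_at_1:
  fixes t :: "'a :: comm_ring_1"
  assumes y: "\<And>i. 0 < i \<Longrightarrow> y i = t ^ 2"
    and "Suc m \<le> n" "0 < i"
  shows "broken_total n y 1 i (Suc m) =
    (1 + t ^ 2) ^ Suc m + 2 * of_nat m * t ^ 2 * (1 + t ^ 2) ^ (m - 1)"
  using assms(2-)
proof (induction m arbitrary: i)
  case 0
  then show ?case using broken_total_1[of n y 1 i] y[of i] by simp
next
  case (Suc m)
  have "broken_total n y 1 i (Suc (Suc m)) =
      (1 + t ^ 2) * broken_total n y 1 (Suc i) (Suc m) + 2 * t ^ 2 * (1 + t ^ 2) ^ m"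
    using Suc.prems y by (subst broken_total_Suc) auto
  also have "broken_total n y 1 (Suc i) (Suc m) =
      (1 + t ^ 2) ^ Suc m + 2 * of_nat m * t ^ 2 * (1 + t ^ 2) ^ (m - 1)"
    using Suc by simp
  finally show ?case
    by (cases m) (simp_all add: algebra_simps)
qed

section \<open>The two generating functions\<close>

text \<open>For \<open>n = 2\<close> the exponent \<open>int n - 3\<close> is \<open>-1\<close>,
  which is why \<open>1 + t ^ 2\<close> is assumed nonzero in that case.\<close>

theorem theorem5p10:
  fixes t q :: "'a :: field" and n :: nat
  assumes "2 \<le> n"
  shows "(q \<noteq> 1 \<longrightarrow>
      (\<Sum>\<pi>\<in>B_arc_permutations n. t ^ fdes n \<pi> * q ^ fmaj n \<pi>) =
        ((1 + t * q) * (1 + t * q ^ n)) / (1 - q) *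
        ((1 - t * q ^ n) * (\<Prod>i=1..n - 2. (1 + t ^ 2 * q ^ (2 * i + 1)))
          - (1 - t) * q * (\<Prod>i=1..n - 2. (1 + t ^ 2 * q ^ (2 * i + 2))))) \<and>
    ((n = 2 \<longrightarrow> 1 + t ^ 2 \<noteq> 0) \<longrightarrow>
      (\<Sum>\<pi>\<in>B_arc_permutations n. t ^ fdes n \<pi>) =
        (1 + t) ^ 3 * (1 + t ^ 2) powi (int n - 3) * (1 + of_nat (n - 2) * t + t ^ 2))"
proof (intro conjI impI)
  obtain l where l: "n = Suc (Suc l)" using assms by (metis add_2_eq_Suc le_Suc_ex)
  {
    assume q: "q \<noteq> 1"
    define y where "y = (\<lambda>i::nat. if i = 0 then t else t ^ 2 * q ^ (2 * i))"
    let ?S = "\<Sum>\<pi>\<in>B_arc_permutations n. t ^ fdes n \<pi> * q ^ fmaj n \<pi>"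
    define R where "R = (\<Prod>i=1..n - 2. (1 + t ^ 2 * q ^ (2 * i + 1)))"
    define P where "P = (\<Prod>i=1..n - 2. (1 + t ^ 2 * q ^ (2 * i + 2)))"
    have R: "(\<Prod>j\<in>{1..<n - 1}. 1 + q * y j) = R"
      unfolding R_def using l by (intro prod.cong) (auto simp: y_def algebra_simps)
    have P: "(\<Prod>j\<in>{1..<n - 1}. 1 + y (1 + j)) = P"
      unfolding P_def using l by (intro prod.cong) (auto simp: y_def algebra_simps)
    have total: "?S = broken_total n y q 0 n + (\<Sum>k\<in>{1..<n}. q ^ k) * ((t + t ^ 2 * q ^ 2) * P)"
      using sum_B_arc_permutations[OF assms, of y t q] unfolding P by (simp add: y_def)
    \<comment> \<open>The step from index \<open>0\<close> is taken separately, since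
      \<open>y 0 = t\<close>; from index \<open>1\<close> on the closed form applies.\<close>
    have V0: "broken_total n y q 0 n =
        (1 + q * t) * broken_total n y q 1 (n - 1) + (t ^ 2 * q ^ 2 + q ^ n * t) * P"
      using broken_total_Suc[of "n - 1" n y q 0] P l by (simp add: y_def)
    have V1: "(1 - q) * broken_total n y q 1 (n - 1) =
        (1 - t ^ 2 * q ^ (2 * n)) * R - (q - t ^ 2 * q ^ (n + 1)) * P"
      using broken_total_closed_form[of y t q "n - 1" n 1] R P l by (simp add: y_def)
    have geo: "(1 - q) * (\<Sum>k\<in>{1..<n}. q ^ k) = q - q ^ n"
      using sum_gp_multiplied[of 1 "Suc l" q] unfolding l atLeastLessThanSuc_atLeastAtMost by simp
    have "(1 - q) * ?S = (1 + q * t) * ((1 - q) * broken_total n y q 1 (n - 1)) +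
        (1 - q) * (t ^ 2 * q ^ 2 + q ^ n * t) * P +
        ((1 - q) * (\<Sum>k\<in>{1..<n}. q ^ k)) * ((t + t ^ 2 * q ^ 2) * P)"
      unfolding total V0 by (simp add: algebra_simps)
    \<comment> \<open>With \<open>q ^ (2 * n)\<close> as the square of \<open>q ^ n\<close>, this is
      a polynomial identity in \<open>t\<close>, \<open>q\<close>, \<open>q ^ n\<close>,
      \<open>R\<close> and \<open>P\<close>.\<close>
    also have "\<dots> = (1 + t * q) * (1 + t * q ^ n) * ((1 - t * q ^ n) * R - (1 - t) * q * P)"
      unfolding V1 geo by (simp add: power_mult mult.commute[of 2 n]) algebra
    finally show "?S = ((1 + t * q) * (1 + t * q ^ n)) / (1 - q) *
        ((1 - t * q ^ n) * (\<Prod>i=1..n - 2. (1 + t ^ 2 * q ^ (2 * i + 1)))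
          - (1 - t) * q * (\<Prod>i=1..n - 2. (1 + t ^ 2 * q ^ (2 * i + 2))))"
      using q unfolding R_def[symmetric] P_def[symmetric] by (simp add: field_simps)
  }
  assume nz: "n = 2 \<longrightarrow> 1 + t ^ 2 \<noteq> 0"
  define y where "y = (\<lambda>i::nat. if i = 0 then t else t ^ 2)"
  let ?c = "1 + t ^ 2"
  have total: "(\<Sum>\<pi>\<in>B_arc_permutations n. t ^ fdes n \<pi>) =
      broken_total n y 1 0 n + of_nat (l + 1) * ((t + t ^ 2) * ?c ^ l)"
    using sum_B_arc_permutations[OF assms, of y t 1] l by (simp add: y_def)
  also have "broken_total n y 1 0 n =
      (1 + t) * broken_total n y 1 1 (Suc l) + (t ^ 2 + t) * ?c ^ l"
    using broken_total_Suc[of "Suc l" n y 1 0] l by (simp add: y_def)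
  also have "broken_total n y 1 1 (Suc l) = ?c ^ Suc l + 2 * of_nat l * t ^ 2 * ?c ^ (l - 1)"
    using l by (intro broken_total_at_1) (auto simp: y_def)
  finally have sum: "(\<Sum>\<pi>\<in>B_arc_permutations n. t ^ fdes n \<pi>) =
      (1 + t) * (?c ^ Suc l + 2 * of_nat l * t ^ 2 * ?c ^ (l - 1)) + (t ^ 2 + t) * ?c ^ l +
      of_nat (l + 1) * ((t + t ^ 2) * ?c ^ l)" .
  show "(\<Sum>\<pi>\<in>B_arc_permutations n. t ^ fdes n \<pi>) =
      (1 + t) ^ 3 * ?c powi (int n - 3) * (1 + of_nat (n - 2) * t + t ^ 2)"
  proof (cases l)
    case 0
    \<comment> \<open>For \<open>n = 2\<close> the last factor of the claim is \<open>?c\<close>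
      itself and cancels its inverse.\<close>
    then have "?c \<noteq> 0" using nz l by simp
    then have "?c powi (int n - 3) * ?c = 1" using 0 l by (simp add: power_int_minus)
    then have "(1 + t) ^ 3 * ?c powi (int n - 3) * (1 + of_nat (n - 2) * t + t ^ 2) = (1 + t) ^ 3"
      using 0 l by (simp add: mult.assoc)
    then show ?thesis unfolding sum using 0 by (simp add: algebra_simps power2_eq_square power3_eq_cube)
  next
    case (Suc r)
    then have "int n - 3 = int r" using l by simp
    then have "?c powi (int n - 3) = ?c ^ r" by simp
    moreover have "(1 + t) * (?c ^ Suc l + 2 * of_nat l * t ^ 2 * ?c ^ (l - 1)) + (t ^ 2 + t) * ?c ^ l +
        of_nat (l + 1) * ((t + t ^ 2) * ?c ^ l) = (1 + t) ^ 3 * ?c ^ r * (1 + of_nat l * t + t ^ 2)"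
      unfolding Suc by simp algebra
    ultimately show ?thesis unfolding sum using l by simp
  qed
qed

end
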